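(* Let $X$ be a Banach space, $\mu$ a finite positive measure on $(\Omega,\Sigma)$, $\Lambda$ a directed set, and let $m:\Sigma\to X$ and $m_\eta:\Sigma\to X$ ($\eta\in\Lambda$) be countably additive vector measures, all of them absolutely continuous with respect to $\mu$, such that $L^1(m)\subseteq\bigcap_{\eta\in\Lambda}L^1(m_\eta)$, with the inclusion $L^1(m)\to L^1(m_\eta)$ having norm one for each $\eta\in\Lambda$. Assume that at least one of the following two conditions holds: (i) for each $f\in L^1(m)$, $$\lim_\eta\ \sup_{A\in\Sigma}\Bigl\|\int f h_A\,dm-\int f h_A\,dm_\eta\Bigr\|_X=0;$$ (ii) for each $x^*\in X^*$, $\lim_\eta\varphi^{m_\eta}_{x^*}=\varphi^m_{x^*}$ in the weak* topology of the dual of $L^1(m)$, i.e. $\lim_\eta\int f\varphi^{m_\eta}_{x^*}\,d\mu=\int f\varphi^m_{x^*}\,d\mu$ for every $f\in L^1(m)$. Then for each $f\in L^1(m)$, $$\lim_{\eta\in\Lambda}\|f\|_{L^1(m_\eta)}=\|f\|_{L^1(m)}.$$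
   Context: Scalars are real. For a countably additive vector measure $m:\Sigma\to X$ and $x^*\in X^*$, $\langle m,x^*\rangle(A):=\langle m(A),x^*\rangle$ is a scalar measure with variation $|\langle m,x^*\rangle|$. The semivariation is $\|m\|(A)=\sup_{\|x^*\|\le 1}|\langle m,x^*\rangle|(A)$, and $m$ is absolutely continuous with respect to $\mu$ if $\mu(A)=0$ implies $\|m\|(A)=0$. Functions that agree off a set of zero semivariation are identified; the inclusion $L^1(m)\to L^1(m_\eta)$ sends the class of $f$ modulo $m$-null sets to the class of the same $f$ modulo $m_\eta$-null sets. A measurable $f:\Omega\to\mathbb R$ is $m$-integrable if it is integrable with respect to $\langle m,x^*\rangle$ for every $x^*\in X^*$ and for each $A\in\Sigma$ there is an element $\int_A f\,dm\in X$ with $\langle\int_A f\,dm,x^*\rangle=\int_A f\,d\langle m,x^*\rangle$ for all $x^*\in X^*$; $\int f\,dm:=\int_\Omega f\,dm$. $L^1(m)$ is the Banach lattice of ($m$-a.e. classes of) $m$-integrable functions with norm $\|f\|_{L^1(m)}=\sup_{x^*\in B_{X^*}}\int|f|\,d|\langle m,x^*\rangle|$. For $A\in\Sigma$, $h_A:=\chi_A-\chi_{A^c}$. For $x^*\in X^*$, $\varphi^m_{x^*}:=\frac{d\langle m,x^*\rangle}{d\mu}$ and $\varphi^{m_\eta}_{x^*}:=\frac{d\langle m_\eta,x^*\rangle}{d\mu}$ are the Radon-Nikodým derivatives, acting as functionals on $L^1(m)$ by $f\mapsto\int f\varphi\,d\mu$. *)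

theory Defs
  imports "HOL-Analysis.Analysis"
begin

section \<open>Directed sets and limits along nets\<close>

definition directed_set :: "'i set \<Rightarrow> ('i \<Rightarrow> 'i \<Rightarrow> bool) \<Rightarrow> bool" where
  "directed_set L le \<longleftrightarrow> L \<noteq> {} \<and> reflp_on L le \<and> transp_on L le \<and>
     (\<forall>a\<in>L. \<forall>b\<in>L. \<exists>c\<in>L. le a c \<and> le b c)"

text \<open>The filter of tails, so that convergence of a net is \<^const>\<open>tendsto\<close> along it.\<close>

definition net_filter :: "'i set \<Rightarrow> ('i \<Rightarrow> 'i \<Rightarrow> bool) \<Rightarrow> 'i filter" where
  "net_filter L le = (INF a\<in>L. principal {i\<in>L. le a i})"

lemma eventually_net_filter:
  assumes "directed_set L le"
  shows "eventually P (net_filter L le) \<longleftrightarrow> (\<exists>a\<in>L. \<forall>i\<in>L. le a i \<longrightarrow> P i)"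
proof -
  have "\<exists>c\<in>L. principal {i\<in>L. le c i} \<le> inf (principal {i\<in>L. le a i}) (principal {i\<in>L. le b i})"
    if ab: "a \<in> L" "b \<in> L" for a b
  proof -
    obtain c where c: "c \<in> L" "le a c" "le b c"
      using assms ab unfolding directed_set_def by blast
    have "transp_on L le" using assms unfolding directed_set_def by blast
    then have "{i\<in>L. le c i} \<subseteq> {i\<in>L. le a i} \<inter> {i\<in>L. le b i}"
      using c ab by (auto dest: transp_onD)
    then show ?thesis using c(1) by (auto simp: inf_principal)
  qed
  moreover have "L \<noteq> {}" using assms unfolding directed_set_def by blast
  ultimately show ?thesis
    unfolding net_filter_def by (subst eventually_INF_base) (auto simp: eventually_principal)
qed


section \<open>Scalar measures\<close>

text \<open>
  In this section \<open>\<nu>\<close> is a countably additive real-valued set function on the sigma-algebra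
  of \<open>M\<close>; the measure carried by \<open>M\<close> plays no role except in \<open>rn_density\<close>.
  The variation and the upper variation of such a \<open>\<nu>\<close> are finite measures, so that
  \<^const>\<open>measure_of\<close> does not alter their values.
\<close>

definition variation :: "'a measure \<Rightarrow> ('a set \<Rightarrow> real) \<Rightarrow> 'a set \<Rightarrow> ennreal" where
  "variation M \<nu> A =
     (SUP P\<in>{P. finite P \<and> P \<subseteq> sets M \<and> partition_on A P}. \<Sum>B\<in>P. ennreal \<bar>\<nu> B\<bar>)"

definition variation_measure :: "'a measure \<Rightarrow> ('a set \<Rightarrow> real) \<Rightarrow> 'a measure" where
  "variation_measure M \<nu> = measure_of (space M) (sets M) (variation M \<nu>)"

text \<open>The positive part in the Jordan decomposition; \<^const>\<open>ennreal\<close> cuts off negative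
  values, which is harmless because \<open>B = {}\<close> is admissible in the supremum. The negative part
  of \<open>\<nu>\<close> is the positive part of \<open>- \<nu>\<close>.\<close>

definition jordan_pos :: "'a measure \<Rightarrow> ('a set \<Rightarrow> real) \<Rightarrow> 'a measure" where
  "jordan_pos M \<nu> =
     measure_of (space M) (sets M) (\<lambda>A. SUP B\<in>{B\<in>sets M. B \<subseteq> A}. ennreal (\<nu> B))"

definition jordan_neg :: "'a measure \<Rightarrow> ('a set \<Rightarrow> real) \<Rightarrow> 'a measure" where
  "jordan_neg M \<nu> = jordan_pos M (\<lambda>A. - \<nu> A)"

definition scalar_integrable :: "'a measure \<Rightarrow> ('a set \<Rightarrow> real) \<Rightarrow> ('a \<Rightarrow> real) \<Rightarrow> bool" where
  "scalar_integrable M \<nu> f \<longleftrightarrow> integrable (variation_measure M \<nu>) f"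

definition scalar_integral ::
    "'a measure \<Rightarrow> ('a set \<Rightarrow> real) \<Rightarrow> 'a set \<Rightarrow> ('a \<Rightarrow> real) \<Rightarrow> real" where
  "scalar_integral M \<nu> A f =
     (LINT \<omega>:A|jordan_pos M \<nu>. f \<omega>) - (LINT \<omega>:A|jordan_neg M \<nu>. f \<omega>)"

text \<open>The Radon-Nikodym derivative of \<open>\<nu>\<close> with respect to \<open>M\<close>, which is unique up to
  \<open>M\<close>-null sets. (The library's \<^const>\<open>RN_deriv\<close> covers positive measures only.)\<close>

definition rn_density :: "'a measure \<Rightarrow> ('a set \<Rightarrow> real) \<Rightarrow> 'a \<Rightarrow> real" where
  "rn_density M \<nu> =
     (SOME \<phi>. integrable M \<phi> \<and> (\<forall>A\<in>sets M. \<nu> A = (LINT \<omega>:A|M. \<phi> \<omega>)))"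


section \<open>Vector measures\<close>

definition vector_measure :: "'a measure \<Rightarrow> ('a set \<Rightarrow> 'b::banach) \<Rightarrow> bool" where
  "vector_measure M m \<longleftrightarrow>
     (\<forall>A :: nat \<Rightarrow> 'a set. range A \<subseteq> sets M \<longrightarrow> disjoint_family A \<longrightarrow>
        (\<lambda>i. m (A i)) sums m (\<Union>i. A i))"

definition dual_measure :: "('a set \<Rightarrow> 'b::banach) \<Rightarrow> ('b \<Rightarrow>\<^sub>L real) \<Rightarrow> 'a set \<Rightarrow> real" where
  "dual_measure m x A = blinfun_apply x (m A)"

definition semivariation :: "'a measure \<Rightarrow> ('a set \<Rightarrow> 'b::banach) \<Rightarrow> 'a set \<Rightarrow> ennreal" where
  "semivariation M m A =
     (SUP x\<in>{x :: 'b \<Rightarrow>\<^sub>L real. norm x \<le> 1}. variation M (dual_measure m x) A)"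

definition vm_absolutely_continuous :: "'a measure \<Rightarrow> ('a set \<Rightarrow> 'b::banach) \<Rightarrow> bool" where
  "vm_absolutely_continuous M m \<longleftrightarrow>
     (\<forall>A\<in>sets M. emeasure M A = 0 \<longrightarrow> semivariation M m A = 0)"

definition vm_integrable :: "'a measure \<Rightarrow> ('a set \<Rightarrow> 'b::banach) \<Rightarrow> ('a \<Rightarrow> real) \<Rightarrow> bool" where
  "vm_integrable M m f \<longleftrightarrow>
     f \<in> borel_measurable M \<and>
     (\<forall>x. scalar_integrable M (dual_measure m x) f) \<and>
     (\<forall>A\<in>sets M. \<exists>y. \<forall>x. blinfun_apply x y = scalar_integral M (dual_measure m x) A f)"

text \<open>The element chosen here is unique, since the dual separates points.\<close>

definition vm_integral ::
    "'a measure \<Rightarrow> ('a set \<Rightarrow> 'b::banach) \<Rightarrow> 'a set \<Rightarrow> ('a \<Rightarrow> real) \<Rightarrow> 'b" where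
  "vm_integral M m A f =
     (SOME y. \<forall>x. blinfun_apply x y = scalar_integral M (dual_measure m x) A f)"

text \<open>
  The elements of the \<open>L\<^sup>1\<close>-space are represented by functions satisfying \<^const>\<open>vm_integrable\<close>
  rather than by classes. The norm takes values in \<open>[0,\<infinity>]\<close>, so that no supremum is
  ill-defined; it is finite on integrable functions.
\<close>

definition L1_norm :: "'a measure \<Rightarrow> ('a set \<Rightarrow> 'b::banach) \<Rightarrow> ('a \<Rightarrow> real) \<Rightarrow> ennreal" where
  "L1_norm M m f =
     (SUP x\<in>{x :: 'b \<Rightarrow>\<^sub>L real. norm x \<le> 1}.
        \<integral>\<^sup>+ \<omega>. ennreal \<bar>f \<omega>\<bar> \<partial>variation_measure M (dual_measure m x))"

text \<open>The second conjunct says that passing from the class modulo \<open>m\<close>-null sets to the class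
  modulo \<open>n\<close>-null sets is well defined.\<close>

definition L1_included ::
    "'a measure \<Rightarrow> ('a set \<Rightarrow> 'b::banach) \<Rightarrow> ('a set \<Rightarrow> 'b) \<Rightarrow> bool" where
  "L1_included M m n \<longleftrightarrow>
     (\<forall>f. vm_integrable M m f \<longrightarrow> vm_integrable M n f) \<and>
     (\<forall>A\<in>sets M. semivariation M m A = 0 \<longrightarrow> semivariation M n A = 0)"

definition L1_inclusion_norm ::
    "'a measure \<Rightarrow> ('a set \<Rightarrow> 'b::banach) \<Rightarrow> ('a set \<Rightarrow> 'b) \<Rightarrow> ennreal" where
  "L1_inclusion_norm M m n =
     (SUP f\<in>{f. vm_integrable M m f \<and> L1_norm M m f \<le> 1}. L1_norm M n f)"

definition sign_fun :: "'a measure \<Rightarrow> 'a set \<Rightarrow> 'a \<Rightarrow> real" where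
  "sign_fun M A \<omega> = indicator A \<omega> - indicator (space M - A) \<omega>"

end

(*
  If phi is the density of a real-valued measure nu with respect to mu, then phi^+, phi^- and
  |phi| are the densities of the Jordan parts and of the variation of nu, so integrals against nu
  are integrals of f * phi. Condition (i), read at A = Omega, implies condition (ii). The inclusion
  norm gives that the norm of f in L^1(m_eta) is at most the norm in L^1(m) for every eta. For the
  lower bound, take c below the norm in L^1(m) and x* in the dual unit ball whose integral of
  |f phi| exceeds c. This integral is the integral of f h_A phi with A = {f phi >= 0}; as f h_A is
  m-integrable, (ii) says that it is approximated by integrals of f h_A against the densities of
  m_eta, none of which exceeds the norm of f in L^1(m_eta).
*)
theory Submission
  imports Defs
begin

section \<open>Densities of signed measures\<close>

locale signed_measure =
  fixes M :: "'a measure" and \<nu> :: "'a set \<Rightarrow> real"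
  assumes sums_UN: "range A \<subseteq> sets M \<Longrightarrow> disjoint_family A \<Longrightarrow> (\<lambda>i::nat. \<nu> (A i)) sums \<nu> (\<Union>i. A i)"
begin

lemma signed_measure_uminus: "signed_measure M (\<lambda>A. - \<nu> A)"
  by unfold_locales (intro sums_minus sums_UN)

lemma signed_empty [simp]: "\<nu> {} = 0"
proof -
  \<comment> \<open>A constant series converges only if its term is zero.\<close>
  have "(\<lambda>i::nat. \<nu> {}) sums \<nu> (\<Union>i::nat. {})"
    by (rule sums_UN) (auto simp: disjoint_family_on_def)
  then show ?thesis
    using sums_summable summable_const_iff by blast
qed

lemma signed_Un:
  assumes "A \<in> sets M" "B \<in> sets M" "A \<inter> B = {}"
  shows "\<nu> (A \<union> B) = \<nu> A + \<nu> B"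
proof -
  have "(\<lambda>i. \<nu> (binaryset A B i)) sums \<nu> (\<Union>i. binaryset A B i)"
    using assms by (intro sums_UN) (auto simp: binaryset_def disjoint_family_on_def)
  then show ?thesis
    using binaryset_sums[of \<nu> A B] sums_unique2 by (fastforce simp: UN_binaryset_eq)
qed

lemma signed_Diff:
  assumes "A \<in> sets M" "B \<in> sets M" "B \<subseteq> A"
  shows "\<nu> (A - B) = \<nu> A - \<nu> B"
proof -
  have "B \<union> (A - B) = A" using assms by auto
  then show ?thesis
    using signed_Un[of B "A - B"] assms by auto
qed

text \<open>The bound concerns all measurable subsets rather than the set itself, so that in a
  splitting of an unbounded set at least one half stays unbounded.\<close>

definition bounded_on :: "'a set \<Rightarrow> bool" where
  "bounded_on E \<longleftrightarrow> (\<exists>K. \<forall>B\<in>sets M. B \<subseteq> E \<longrightarrow> \<bar>\<nu> B\<bar> \<le> K)"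

lemma bounded_on_Un:
  assumes "bounded_on A" "bounded_on B" "A \<in> sets M" "B \<in> sets M" "A \<inter> B = {}"
  shows "bounded_on (A \<union> B)"
proof -
  obtain K where K: "\<And>C. C \<in> sets M \<Longrightarrow> C \<subseteq> A \<Longrightarrow> \<bar>\<nu> C\<bar> \<le> K"
    using assms(1) unfolding bounded_on_def by blast
  obtain K' where K': "\<And>C. C \<in> sets M \<Longrightarrow> C \<subseteq> B \<Longrightarrow> \<bar>\<nu> C\<bar> \<le> K'"
    using assms(2) unfolding bounded_on_def by blast
  have "\<bar>\<nu> C\<bar> \<le> K + K'" if C: "C \<in> sets M" "C \<subseteq> A \<union> B" for C
  proof -
    have "C = (C \<inter> A) \<union> (C \<inter> B)" using C by auto
    then have "\<nu> C = \<nu> (C \<inter> A) + \<nu> (C \<inter> B)"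
      using signed_Un[of "C \<inter> A" "C \<inter> B"] C assms by auto
    moreover have "\<bar>\<nu> (C \<inter> A)\<bar> \<le> K" "\<bar>\<nu> (C \<inter> B)\<bar> \<le> K'"
      using C assms K K' by auto
    ultimately show ?thesis by linarith
  qed
  then show ?thesis unfolding bounded_on_def by blast
qed

text \<open>A subset \<open>B\<close> whose measure exceeds that of \<open>E\<close> by more than 1
  in absolute value leaves a complement \<open>E - B\<close> of measure at least 1 in absolute value
  too. Hence whichever of \<open>B\<close> and \<open>E - B\<close> remains unbounded can be kept
  and the other one shed.\<close>

lemma unbounded_split:
  assumes "E \<in> sets M" "\<not> bounded_on E"
  shows "\<exists>F\<in>sets M. F \<subseteq> E \<and> \<not> bounded_on F \<and> 1 \<le> \<bar>\<nu> (E - F)\<bar>"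
proof -
  obtain B where B: "B \<in> sets M" "B \<subseteq> E" "\<not> \<bar>\<nu> B\<bar> \<le> \<bar>\<nu> E\<bar> + 1"
    using assms(2) unfolding bounded_on_def by blast
  have d: "\<nu> (E - B) = \<nu> E - \<nu> B" using signed_Diff B assms by auto
  have "E = B \<union> (E - B)" using B by auto
  then have "\<not> bounded_on B \<or> \<not> bounded_on (E - B)"
    using bounded_on_Un[of B "E - B"] assms B by auto
  then show ?thesis
  proof
    assume "\<not> bounded_on B"
    moreover have "1 \<le> \<bar>\<nu> (E - B)\<bar>" using d B by linarith
    ultimately show ?thesis using B by blast
  next
    assume "\<not> bounded_on (E - B)"
    moreover have "E - (E - B) = B" using B by auto
    ultimately show ?thesis using B assms by (intro bexI[of _ "E - B"]) auto
  qed
qed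

text \<open>An unbounded set would shed pairwise disjoint pieces of measure at least \<open>1\<close> in absolute
  value forever, against the convergence of the series over those pieces.\<close>

lemma bounded_on_space: "bounded_on (space M)"
proof (rule ccontr)
  assume nb: "\<not> bounded_on (space M)"
  define Q where "Q E \<longleftrightarrow> E \<in> sets M \<and> \<not> bounded_on E" for E
  have "\<exists>E. \<forall>n. Q (E n) \<and> E (Suc n) \<subseteq> E n \<and> 1 \<le> \<bar>\<nu> (E n - E (Suc n))\<bar>"
  proof (rule dependent_nat_choice)
    show "\<exists>E. Q E" using nb unfolding Q_def by blast
    show "\<exists>F. Q F \<and> F \<subseteq> E \<and> 1 \<le> \<bar>\<nu> (E - F)\<bar>" if "Q E" for E
      using that unbounded_split[of E] unfolding Q_def by blast
  qed
  then obtain E where E: "\<And>n. Q (E n)" "\<And>n. E (Suc n) \<subseteq> E n" "\<And>n. 1 \<le> \<bar>\<nu> (E n - E (Suc n))\<bar>"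
    by blast
  have dec: "decseq E" using E(2) by (rule decseq_SucI)
  have "(E i - E (Suc i)) \<inter> (E j - E (Suc j)) = {}" if "i < j" for i j
    using decseqD[OF dec, of "Suc i" j] that by auto
  then have "disjoint_family (\<lambda>n. E n - E (Suc n))"
    unfolding disjoint_family_on_def by (metis Int_commute linorder_neqE_nat)
  moreover have "range (\<lambda>n. E n - E (Suc n)) \<subseteq> sets M"
    using E(1) unfolding Q_def by auto
  ultimately have "(\<lambda>n. \<nu> (E n - E (Suc n))) sums \<nu> (\<Union>n. E n - E (Suc n))"
    using sums_UN by blast
  then have "(\<lambda>n. \<nu> (E n - E (Suc n))) \<longlonglongrightarrow> 0"
    using sums_summable summable_LIMSEQ_zero by blast
  then have "(\<lambda>n. \<bar>\<nu> (E n - E (Suc n))\<bar>) \<longlonglongrightarrow> 0"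
    by (rule tendsto_rabs_zero)
  then have "(1::real) \<le> 0"
    by (rule LIMSEQ_le_const) (use E(3) in auto)
  then show False by simp
qed

section \<open>The positive part as a finite measure, and the Jordan decomposition\<close>

definition upper :: "'a set \<Rightarrow> ennreal" where
  "upper A = (SUP B\<in>{B\<in>sets M. B \<subseteq> A}. ennreal (\<nu> B))"

text \<open>The union of a competitor for \<open>A\<close> and a competitor for \<open>C\<close>
  competes for \<open>A \<union> C\<close>, and its measure is the sum because the two are
  disjoint.\<close>

lemma upper_Un_ge:
  assumes "A \<inter> C = {}"
  shows "upper A + upper C \<le> upper (A \<union> C)"
proof -
  have *: "ennreal (\<nu> B) + ennreal (\<nu> D) \<le> upper (A \<union> C)"
    if B: "B \<in> sets M" "B \<subseteq> A" and D: "D \<in> sets M" "D \<subseteq> C" for B D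
  proof -
    \<comment> \<open>Trading a set of negative measure for the empty set keeps the truncated value
      and makes both real values nonnegative, so that addition in \<open>ennreal\<close> agrees with
      real addition.\<close>
    define B' where "B' = (if \<nu> B < 0 then {} else B)"
    define D' where "D' = (if \<nu> D < 0 then {} else D)"
    have *: "ennreal (\<nu> B) = ennreal (\<nu> B')" "ennreal (\<nu> D) = ennreal (\<nu> D')" "0 \<le> \<nu> B'" "0 \<le> \<nu> D'"
      unfolding B'_def D'_def by (auto simp: ennreal_neg)
    have s: "B' \<in> sets M" "D' \<in> sets M" "B' \<subseteq> A" "D' \<subseteq> C"
      using B D unfolding B'_def D'_def by auto
    have "B' \<inter> D' = {}" using s assms by blast
    then have "ennreal (\<nu> B') + ennreal (\<nu> D') = ennreal (\<nu> (B' \<union> D'))"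
      using signed_Un[of B' D'] s assms *(3,4) by (subst ennreal_plus[symmetric]) auto
    also have "\<dots> \<le> upper (A \<union> C)"
      unfolding upper_def using s by (intro SUP_upper) auto
    finally show ?thesis using * by simp
  qed
  have ne: "{B \<in> sets M. B \<subseteq> A} \<noteq> {}" "{B \<in> sets M. B \<subseteq> C} \<noteq> {}" by auto
  have "ennreal (\<nu> B) + upper C \<le> upper (A \<union> C)" if "B \<in> sets M" "B \<subseteq> A" for B
    unfolding upper_def[of C] ennreal_SUP_add_right[OF ne(2)]
    using that * by (intro SUP_least) auto
  then show ?thesis
    unfolding upper_def[of A] ennreal_SUP_add_left[OF ne(1), symmetric]
    by (intro SUP_least) auto
qed

lemma upper_mono: "A \<subseteq> B \<Longrightarrow> upper A \<le> upper B"
  unfolding upper_def by (intro SUP_subset_mono) auto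

lemma upper_empty [simp]: "upper {} = 0"
proof -
  have "{B \<in> sets M. B \<subseteq> {}} = {{}}" by auto
  then show ?thesis unfolding upper_def by simp
qed

text \<open>Superadditivity and monotonicity bound every partial sum from above by the value of the
  union. Conversely, a competitor \<open>B\<close> for the union is cut into the pieces
  \<open>B \<inter> A i\<close>, and the series of their measures converges to that of
  \<open>B\<close>.\<close>

lemma countably_additive_upper: "countably_additive (sets M) upper"
proof (rule countably_additiveI)
  fix A :: "nat \<Rightarrow> 'a set"
  assume A: "range A \<subseteq> sets M" "disjoint_family A"
  have fin: "(\<Sum>i<n. upper (A i)) \<le> upper (\<Union>i<n. A i)" for n
  proof (induction n)
    case (Suc n)
    have "(\<Sum>i<Suc n. upper (A i)) = upper (A n) + (\<Sum>i<n. upper (A i))"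
      by (simp add: add.commute)
    also have "\<dots> \<le> upper (A n) + upper (\<Union>i<n. A i)"
      using Suc by (rule add_left_mono)
    also have "\<dots> \<le> upper (A n \<union> (\<Union>i<n. A i))"
    proof (rule upper_Un_ge)
      show "A n \<inter> (\<Union>i<n. A i) = {}"
        using disjoint_family_onD[OF A(2), of n] by (force simp: disjoint_iff)
    qed
    also have "A n \<union> (\<Union>i<n. A i) = (\<Union>i<Suc n. A i)"
      by (auto simp: less_Suc_eq)
    finally show ?case .
  qed simp
  show "(\<Sum>i. upper (A i)) = upper (\<Union>i. A i)"
  proof (rule antisym)
    show "(\<Sum>i. upper (A i)) \<le> upper (\<Union>i. A i)"
    proof (rule suminf_le_const)
      fix n show "(\<Sum>i<n. upper (A i)) \<le> upper (\<Union>i. A i)"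
        by (rule order_trans[OF fin upper_mono]) auto
    qed auto
    have "ennreal (\<nu> B) \<le> (\<Sum>i. upper (A i))" if B: "B \<in> sets M" "B \<subseteq> (\<Union>i. A i)" for B
    proof -
      have "(\<lambda>i. \<nu> (B \<inter> A i)) sums \<nu> (\<Union>i. B \<inter> A i)"
        using A B by (intro sums_UN) (auto simp: disjoint_family_on_def)
      moreover have "(\<Union>i. B \<inter> A i) = B" using B by auto
      ultimately have "(\<lambda>n. \<Sum>i<n. \<nu> (B \<inter> A i)) \<longlonglongrightarrow> \<nu> B"
        by (simp add: sums_def)
      then have lim: "(\<lambda>n. ennreal (\<Sum>i<n. \<nu> (B \<inter> A i))) \<longlonglongrightarrow> ennreal (\<nu> B)"
        by (rule tendsto_ennrealI)
      show ?thesis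
      proof (rule LIMSEQ_le_const2[OF lim], intro exI allI impI)
        fix n :: nat
        \<comment> \<open>Some pieces may have negative measure; replacing these terms by 0 only
          enlarges the sum and permits a comparison term by term in \<open>ennreal\<close>.\<close>
        have "ennreal (\<Sum>i<n. \<nu> (B \<inter> A i)) \<le> ennreal (\<Sum>i<n. max 0 (\<nu> (B \<inter> A i)))"
          by (intro ennreal_leI sum_mono) auto
        also have "\<dots> = (\<Sum>i<n. ennreal (max 0 (\<nu> (B \<inter> A i))))"
          by (simp add: sum_ennreal)
        also have "\<dots> \<le> (\<Sum>i<n. upper (A i))"
        proof (rule sum_mono)
          fix i
          have "ennreal (max 0 (\<nu> (B \<inter> A i))) = ennreal (\<nu> (B \<inter> A i))"
            by (auto simp: max_def ennreal_neg)
          also have "\<dots> \<le> upper (A i)"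
            unfolding upper_def using A B by (intro SUP_upper) auto
          finally show "ennreal (max 0 (\<nu> (B \<inter> A i))) \<le> upper (A i)" .
        qed
        also have "\<dots> \<le> (\<Sum>i. upper (A i))"
          by (intro sum_le_suminf) auto
        finally show "ennreal (\<Sum>i<n. \<nu> (B \<inter> A i)) \<le> (\<Sum>i. upper (A i))" .
      qed
    qed
    then show "upper (\<Union>i. A i) \<le> (\<Sum>i. upper (A i))"
      unfolding upper_def[of "\<Union>i. A i"] by (intro SUP_least) auto
  qed
qed

lemma sets_jordan_pos [simp]: "sets (jordan_pos M \<nu>) = sets M"
  and space_jordan_pos [simp]: "space (jordan_pos M \<nu>) = space M"
  unfolding jordan_pos_def by simp_all

lemma emeasure_jordan_pos:
  assumes "A \<in> sets M"
  shows "emeasure (jordan_pos M \<nu>) A = upper A"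
proof -
  have "jordan_pos M \<nu> = measure_of (space M) (sets M) upper"
    unfolding jordan_pos_def upper_def by simp
  then show ?thesis
    using assms countably_additive_upper
    by (simp add: emeasure_measure_of_sigma sets.sigma_algebra_axioms positive_def)
qed

text \<open>This is where boundedness of a real-valued countably additive set function
  enters.\<close>

lemma finite_measure_jordan_pos: "finite_measure (jordan_pos M \<nu>)"
proof
  obtain K where K: "\<And>B. B \<in> sets M \<Longrightarrow> B \<subseteq> space M \<Longrightarrow> \<bar>\<nu> B\<bar> \<le> K"
    using bounded_on_space unfolding bounded_on_def by blast
  have "upper (space M) \<le> ennreal K"
    unfolding upper_def using K by (intro SUP_least ennreal_leI) force
  also have "\<dots> < \<infinity>" by simp
  finally show "emeasure (jordan_pos M \<nu>) (space (jordan_pos M \<nu>)) \<noteq> \<infinity>"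
    by (simp add: emeasure_jordan_pos)
qed

text \<open>The argument compares suprema instead of constructing a Hahn decomposition. For
  \<open>B \<subseteq> A\<close> the measure of \<open>B\<close> is that of \<open>A\<close> minus
  that of \<open>A - B\<close>, hence at most the measure of \<open>A\<close> plus the negative part
  of \<open>A\<close>; the supremum over \<open>B\<close> gives one inequality. Exchanging the signs
  gives the other.\<close>

lemma jordan_decomposition:
  assumes A: "A \<in> sets M"
  shows "\<nu> A = measure (jordan_pos M \<nu>) A - measure (jordan_neg M \<nu>) A"
proof -
  interpret neg: signed_measure M "\<lambda>A. - \<nu> A" by (rule signed_measure_uminus)
  interpret P: finite_measure "jordan_pos M \<nu>" by (rule finite_measure_jordan_pos)
  interpret N: finite_measure "jordan_neg M \<nu>"
    unfolding jordan_neg_def by (rule neg.finite_measure_jordan_pos)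
  let ?p = "measure (jordan_pos M \<nu>) A" and ?n = "measure (jordan_neg M \<nu>) A"
  have p: "\<nu> B \<le> ?p" if "B \<in> sets M" "B \<subseteq> A" for B
  proof -
    have "ennreal (\<nu> B) \<le> upper A" unfolding upper_def using that by (intro SUP_upper) auto
    then show ?thesis
      using A by (simp add: emeasure_jordan_pos[symmetric] P.emeasure_eq_measure)
  qed
  have n: "- \<nu> B \<le> ?n" if "B \<in> sets M" "B \<subseteq> A" for B
  proof -
    have "ennreal (- \<nu> B) \<le> neg.upper A" unfolding neg.upper_def using that by (intro SUP_upper) auto
    then show ?thesis
      using A N.emeasure_eq_measure unfolding jordan_neg_def
      by (simp add: neg.emeasure_jordan_pos[symmetric])
  qed
  have D: "\<nu> B + \<nu> (A - B) = \<nu> A" if "B \<in> sets M" "B \<subseteq> A" for B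
    using signed_Diff A that by simp
  have le: "0 \<le> \<nu> A + ?n" using n[OF A] by simp
  have "upper A \<le> ennreal (\<nu> A + ?n)"
    unfolding upper_def
  proof (intro SUP_least ennreal_leI)
    fix B assume "B \<in> {B \<in> sets M. B \<subseteq> A}"
    then have B: "B \<in> sets M" "B \<subseteq> A" by auto
    show "\<nu> B \<le> \<nu> A + ?n" using D[OF B] n[of "A - B"] A B by auto
  qed
  then have 1: "?p \<le> \<nu> A + ?n"
    using A le by (simp add: emeasure_jordan_pos[symmetric] P.emeasure_eq_measure)
  have le: "0 \<le> ?p - \<nu> A" using p[OF A] by simp
  have "neg.upper A \<le> ennreal (?p - \<nu> A)"
    unfolding neg.upper_def
  proof (intro SUP_least ennreal_leI)
    fix B assume "B \<in> {B \<in> sets M. B \<subseteq> A}"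
    then have B: "B \<in> sets M" "B \<subseteq> A" by auto
    show "- \<nu> B \<le> ?p - \<nu> A" using D[OF B] p[of "A - B"] A B by auto
  qed
  then have "?n \<le> ?p - \<nu> A"
    using A le N.emeasure_eq_measure unfolding jordan_neg_def
    by (simp add: neg.emeasure_jordan_pos[symmetric])
  with 1 show ?thesis by linarith
qed

end

section \<open>Radon-Nikodym densities of absolutely continuous signed measures\<close>

locale ac_signed_measure = finite_measure M + signed_measure M \<nu>
  for M :: "'a measure" and \<nu> :: "'a set \<Rightarrow> real" +
  assumes null: "A \<in> sets M \<Longrightarrow> emeasure M A = 0 \<Longrightarrow> \<nu> A = 0"
begin

lemma ac_signed_measure_uminus: "ac_signed_measure M (\<lambda>A. - \<nu> A)"
proof -
  interpret neg: signed_measure M "\<lambda>A. - \<nu> A" by (rule signed_measure_uminus)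
  show ?thesis by unfold_locales (use null in auto)
qed

text \<open>Measurable subsets of a null set are null, so the supremum defining the positive part
  vanishes on null sets and the Radon-Nikodym theorem for positive measures applies. Finiteness of
  the positive part makes the density real-valued and integrable.\<close>

lemma jordan_pos_density:
  "\<exists>p. integrable M p \<and> (\<forall>x. 0 \<le> p x) \<and>
     (\<forall>A\<in>sets M. measure (jordan_pos M \<nu>) A = (LINT \<omega>:A|M. p \<omega>))"
proof -
  interpret P: finite_measure "jordan_pos M \<nu>" by (rule finite_measure_jordan_pos)
  have ac: "absolutely_continuous M (jordan_pos M \<nu>)"
    unfolding absolutely_continuous_def
  proof
    fix A assume "A \<in> null_sets M"
    then have A: "A \<in> sets M" "emeasure M A = 0" by auto
    have "ennreal (\<nu> B) = 0" if "B \<in> sets M" "B \<subseteq> A" for B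
      using null[of B] that A emeasure_mono[of B A M] by auto
    then have "upper A \<le> 0" unfolding upper_def by (intro SUP_least) auto
    then show "A \<in> null_sets (jordan_pos M \<nu>)"
      using A by (auto simp: null_sets_def emeasure_jordan_pos)
  qed
  obtain p where p: "p \<in> borel_measurable M" "AE x in M. RN_deriv M (jordan_pos M \<nu>) x = ennreal (p x)"
      "\<And>x. 0 \<le> p x"
    using real_RN_deriv[OF P.finite_measure_axioms ac] by auto
  have "density M (\<lambda>x. ennreal (p x)) = density M (RN_deriv M (jordan_pos M \<nu>))"
    using p by (intro density_cong) auto
  then have d: "density M (\<lambda>x. ennreal (p x)) = jordan_pos M \<nu>"
    using density_RN_deriv[OF ac] by simp
  have e: "emeasure (jordan_pos M \<nu>) A = (\<integral>\<^sup>+x. ennreal (p x * indicator A x) \<partial>M)" if "A \<in> sets M" for A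
    using emeasure_density[of p M A] p(1) that unfolding d
    by (simp add: indicator_def if_distrib cong: if_cong) (auto intro!: nn_integral_cong)
  have "(\<integral>\<^sup>+x. ennreal (p x) \<partial>M) = emeasure (jordan_pos M \<nu>) (space M)"
    using e[OF sets.top] by (auto intro!: nn_integral_cong)
  then have int: "integrable M p"
    using p by (intro integrableI_nonneg) (auto simp: less_top[symmetric])
  have "measure (jordan_pos M \<nu>) A = (LINT \<omega>:A|M. p \<omega>)" if A: "A \<in> sets M" for A
  proof -
    have "(LINT \<omega>:A|M. p \<omega>) = enn2real (\<integral>\<^sup>+x. ennreal (p x * indicator A x) \<partial>M)"
      unfolding set_lebesgue_integral_def
      using p A by (subst integral_eq_nn_integral) (auto simp: mult.commute)
    then show ?thesis using e[OF A] by (simp add: measure_def)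
  qed
  then show ?thesis using int p by blast
qed

text \<open>The densities of the two Jordan parts are subtracted. Existence is what gives the choice
  in \<open>rn_density\<close> its meaning.\<close>

lemma rn_density_exists:
  "\<exists>\<phi>. integrable M \<phi> \<and> (\<forall>A\<in>sets M. \<nu> A = (LINT \<omega>:A|M. \<phi> \<omega>))"
proof -
  interpret neg: ac_signed_measure M "\<lambda>A. - \<nu> A" by (rule ac_signed_measure_uminus)
  obtain p where p: "integrable M p" "\<And>A. A \<in> sets M \<Longrightarrow> measure (jordan_pos M \<nu>) A = (LINT \<omega>:A|M. p \<omega>)"
    using jordan_pos_density by blast
  obtain n where n: "integrable M n" "\<And>A. A \<in> sets M \<Longrightarrow> measure (jordan_neg M \<nu>) A = (LINT \<omega>:A|M. n \<omega>)"
    using neg.jordan_pos_density unfolding jordan_neg_def by blast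
  have "\<nu> A = (LINT \<omega>:A|M. p \<omega> - n \<omega>)" if A: "A \<in> sets M" for A
  proof -
    have "set_integrable M A p" "set_integrable M A n"
      unfolding set_integrable_def by (intro integrable_mult_indicator A p(1) n(1))+
    then show ?thesis
      using jordan_decomposition[OF A] p(2)[OF A] n(2)[OF A] by (simp add: set_integral_diff)
  qed
  then show ?thesis using p n by (intro exI[of _ "\<lambda>x. p x - n x"]) auto
qed

lemma integrable_rn_density: "integrable M (rn_density M \<nu>)"
  and rn_density: "A \<in> sets M \<Longrightarrow> \<nu> A = (LINT \<omega>:A|M. rn_density M \<nu> \<omega>)"
  using someI_ex[OF rn_density_exists] unfolding rn_density_def by auto

lemma measurable_rn_density [measurable]: "rn_density M \<nu> \<in> borel_measurable M"
  using integrable_rn_density by (rule borel_measurable_integrable)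

end

section \<open>Jordan parts, variation and integrals computed from a density\<close>

lemma integrable_abs_mult_iff:
  fixes f g :: "'a \<Rightarrow> real"
  assumes [measurable]: "f \<in> borel_measurable M" "g \<in> borel_measurable M"
  shows "integrable M (\<lambda>\<omega>. \<bar>g \<omega>\<bar> * f \<omega>) \<longleftrightarrow> integrable M (\<lambda>\<omega>. f \<omega> * g \<omega>)"
proof
  assume "integrable M (\<lambda>\<omega>. \<bar>g \<omega>\<bar> * f \<omega>)"
  then show "integrable M (\<lambda>\<omega>. f \<omega> * g \<omega>)"
    by (rule Bochner_Integration.integrable_bound) (auto simp: abs_mult)
next
  assume "integrable M (\<lambda>\<omega>. f \<omega> * g \<omega>)"
  then show "integrable M (\<lambda>\<omega>. \<bar>g \<omega>\<bar> * f \<omega>)"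
    by (rule Bochner_Integration.integrable_bound) (auto simp: abs_mult)
qed

lemma emeasure_density_real:
  fixes g :: "'a \<Rightarrow> real"
  assumes "integrable M g" "\<And>\<omega>. 0 \<le> g \<omega>" "A \<in> sets M"
  shows "emeasure (density M (\<lambda>\<omega>. ennreal (g \<omega>))) A = ennreal (LINT \<omega>:A|M. g \<omega>)"
proof -
  have [measurable]: "g \<in> borel_measurable M" using assms by auto
  have "emeasure (density M (\<lambda>\<omega>. ennreal (g \<omega>))) A = (\<integral>\<^sup>+\<omega>. ennreal (indicator A \<omega> *\<^sub>R g \<omega>) \<partial>M)"
    using assms by (subst emeasure_density) (auto intro!: nn_integral_cong simp: indicator_def)
  also have "\<dots> = ennreal (LINT \<omega>:A|M. g \<omega>)"
    unfolding set_lebesgue_integral_def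
    using assms integrable_mult_indicator[of A M g] by (intro nn_integral_eq_integral) auto
  finally show ?thesis .
qed

text \<open>The value of \<open>measure_of\<close> is determined by the set function on
  \<open>sets M\<close>, and the density supplies countable additivity. The suprema in
  \<open>jordan_pos\<close> and \<open>variation\<close> therefore only have to be evaluated set by
  set.\<close>

lemma measure_of_eq_density:
  assumes "\<And>A. A \<in> sets M \<Longrightarrow> F A = emeasure (density M g) A"
  shows "measure_of (space M) (sets M) F = density M g"
proof -
  have "measure_of (space M) (sets M) F = measure_of (space M) (sets M) (emeasure (density M g))"
    using assms by (intro measure_of_eq sets.space_closed) (simp add: sets.sigma_sets_eq)
  then show ?thesis
    using measure_of_of_measure[of "density M g"] by simp
qed

context
  fixes M :: "'a measure" and \<nu> :: "'a set \<Rightarrow> real" and \<phi> :: "'a \<Rightarrow> real"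
  assumes int: "integrable M \<phi>"
    and eq: "\<And>A. A \<in> sets M \<Longrightarrow> \<nu> A = (LINT \<omega>:A|M. \<phi> \<omega>)"
begin

lemma measurable_signed_density [measurable]: "\<phi> \<in> borel_measurable M"
  using int by auto

lemma integrable_indicator_density:
  assumes "A \<in> sets M"
  shows "integrable M (\<lambda>\<omega>. indicator A \<omega> *\<^sub>R \<phi> \<omega>)"
    and "integrable M (\<lambda>\<omega>. indicator A \<omega> *\<^sub>R \<bar>\<phi> \<omega>\<bar>)"
    and "integrable M (\<lambda>\<omega>. indicator A \<omega> *\<^sub>R max 0 (\<phi> \<omega>))"
  by (intro integrable_mult_indicator integrable_abs integrable_max integrable_zero assms int)+

text \<open>The supremum over subsets of \<open>A\<close> is attained on the part of
  \<open>A\<close> where \<phi> is nonnegative. As \<phi> is an arbitrary density here, the result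
  also covers the negative part, through -\<phi> as a density of -\<nu>.\<close>

lemma jordan_pos_eq_density: "jordan_pos M \<nu> = density M (\<lambda>\<omega>. ennreal (max 0 (\<phi> \<omega>)))"
  unfolding jordan_pos_def
proof (rule measure_of_eq_density)
  fix A assume A: "A \<in> sets M"
  let ?S = "A \<inter> {\<omega>\<in>space M. 0 \<le> \<phi> \<omega>}"
  have S: "?S \<in> sets M" using A by measurable
  have D: "emeasure (density M (\<lambda>\<omega>. ennreal (max 0 (\<phi> \<omega>)))) A = ennreal (LINT \<omega>:A|M. max 0 (\<phi> \<omega>))"
    using A int by (intro emeasure_density_real) (auto intro!: integrable_max)
  have "\<nu> ?S = (LINT \<omega>:A|M. max 0 (\<phi> \<omega>))"
    unfolding eq[OF S] set_lebesgue_integral_def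
    by (rule Bochner_Integration.integral_cong) (auto simp: indicator_def)
  then have "ennreal (LINT \<omega>:A|M. max 0 (\<phi> \<omega>)) \<le> (SUP B\<in>{B\<in>sets M. B \<subseteq> A}. ennreal (\<nu> B))"
    using S by (intro SUP_upper2[of ?S]) auto
  moreover have "\<nu> B \<le> (LINT \<omega>:A|M. max 0 (\<phi> \<omega>))" if B: "B \<in> sets M" "B \<subseteq> A" for B
    unfolding eq[OF B(1)] set_lebesgue_integral_def
    using A B by (intro integral_mono integrable_indicator_density) (auto simp: indicator_def)
  then have "(SUP B\<in>{B\<in>sets M. B \<subseteq> A}. ennreal (\<nu> B)) \<le> ennreal (LINT \<omega>:A|M. max 0 (\<phi> \<omega>))"
    by (intro SUP_least ennreal_leI) auto
  ultimately show "(SUP B\<in>{B\<in>sets M. B \<subseteq> A}. ennreal (\<nu> B)) =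
      emeasure (density M (\<lambda>\<omega>. ennreal (max 0 (\<phi> \<omega>)))) A"
    unfolding D by (rule antisym[rotated])
qed

text \<open>On each block of a partition the absolute value of an integral is at most the integral
  of |\<phi>|, which bounds the variation. The partition of \<open>A\<close> by the sign of \<phi>
  attains this bound.\<close>

lemma variation_measure_eq_density: "variation_measure M \<nu> = density M (\<lambda>\<omega>. ennreal \<bar>\<phi> \<omega>\<bar>)"
  unfolding variation_measure_def
proof (rule measure_of_eq_density)
  let ?D = "density M (\<lambda>\<omega>. ennreal \<bar>\<phi> \<omega>\<bar>)"
  fix A assume A: "A \<in> sets M"
  have D: "emeasure ?D B = ennreal (LINT \<omega>:B|M. \<bar>\<phi> \<omega>\<bar>)" if "B \<in> sets M" for B
    using that int by (intro emeasure_density_real) auto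
  have le: "ennreal \<bar>\<nu> B\<bar> \<le> emeasure ?D B" if B: "B \<in> sets M" for B
  proof -
    have "\<bar>\<nu> B\<bar> \<le> (LINT \<omega>|M. \<bar>indicator B \<omega> *\<^sub>R \<phi> \<omega>\<bar>)"
      unfolding eq[OF B] set_lebesgue_integral_def by (rule integral_abs_bound)
    also have "\<dots> = (LINT \<omega>:B|M. \<bar>\<phi> \<omega>\<bar>)"
      unfolding set_lebesgue_integral_def by (simp add: abs_mult)
    finally show ?thesis using D[OF B] by (simp add: ennreal_leI)
  qed
  show "variation M \<nu> A = emeasure ?D A"
  proof (rule antisym)
    show "variation M \<nu> A \<le> emeasure ?D A"
      unfolding variation_def
    proof (rule SUP_least)
      fix P assume "P \<in> {P. finite P \<and> P \<subseteq> sets M \<and> partition_on A P}"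
      then have P: "finite P" "P \<subseteq> sets M" "\<Union>P = A" "disjoint P"
        by (auto simp: partition_on_def)
      have "(\<Sum>B\<in>P. ennreal \<bar>\<nu> B\<bar>) \<le> (\<Sum>B\<in>P. emeasure ?D B)"
        using P le by (intro sum_mono) auto
      also have "\<dots> = emeasure ?D (\<Union>B\<in>P. B)"
        using P by (intro sum_emeasure) (auto simp: disjoint_family_on_def disjoint_def)
      finally show "(\<Sum>B\<in>P. ennreal \<bar>\<nu> B\<bar>) \<le> emeasure ?D A"
        using P by simp
    qed
    let ?X = "A \<inter> {\<omega>\<in>space M. 0 \<le> \<phi> \<omega>}" and ?Y = "A \<inter> {\<omega>\<in>space M. \<phi> \<omega> < 0}"
    have X: "?X \<in> sets M" and Y: "?Y \<in> sets M" using A by measurable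
    have XY: "?X \<union> ?Y = A" "?X \<inter> ?Y = {}" using sets.sets_into_space[OF A] by auto
    have "\<nu> ?X = (LINT \<omega>:?X|M. \<bar>\<phi> \<omega>\<bar>)"
      unfolding eq[OF X] set_lebesgue_integral_def
      by (rule Bochner_Integration.integral_cong) (auto simp: indicator_def)
    then have 1: "emeasure ?D ?X \<le> ennreal \<bar>\<nu> ?X\<bar>" using D[OF X] by (simp add: ennreal_leI)
    have "- \<nu> ?Y = (LINT \<omega>:?Y|M. \<bar>\<phi> \<omega>\<bar>)"
      unfolding eq[OF Y] set_lebesgue_integral_def integral_minus[symmetric]
      by (rule Bochner_Integration.integral_cong) (auto simp: indicator_def)
    then have 2: "emeasure ?D ?Y \<le> ennreal \<bar>\<nu> ?Y\<bar>" using D[OF Y] by (metis abs_ge_minus_self ennreal_leI)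
    have e: "\<nu> {} = 0" using eq[of "{}"] by (simp add: set_lebesgue_integral_def)
    have "emeasure ?D A = emeasure ?D ?X + emeasure ?D ?Y"
      using plus_emeasure[of ?X ?D ?Y] X Y XY by simp
    also have "\<dots> \<le> ennreal \<bar>\<nu> ?X\<bar> + ennreal \<bar>\<nu> ?Y\<bar>"
      using 1 2 by (rule add_mono)
    \<comment> \<open>The two disjoint pieces coincide only if both are empty; the set then has a
      single element, and both sides are 0.\<close>
    also have "\<dots> = (\<Sum>B\<in>{?X, ?Y}. ennreal \<bar>\<nu> B\<bar>)"
      using XY(2) e by (cases "?X = ?Y") auto
    \<comment> \<open>Blocks of a partition are nonempty by \<open>partition_on\<close>, so an empty
      piece is dropped; it contributes 0.\<close>
    also have "\<dots> = (\<Sum>B\<in>{?X, ?Y} - {{}}. ennreal \<bar>\<nu> B\<bar>)"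
      using e by (intro sum.mono_neutral_right) auto
    also have "\<dots> \<le> variation M \<nu> A"
      unfolding variation_def
    proof (rule SUP_upper)
      have "partition_on A ({X, Y} - {{}})" if "X \<union> Y = A" "X \<inter> Y = {}" for X Y
        using that unfolding partition_on_def disjoint_def by (auto simp: Int_commute)
      from this[OF XY] have "partition_on A ({?X, ?Y} - {{}})" .
      then show "{?X, ?Y} - {{}} \<in> {P. finite P \<and> P \<subseteq> sets M \<and> partition_on A P}"
        using X Y by auto
    qed
    finally show "emeasure ?D A \<le> variation M \<nu> A" .
  qed
qed

lemma scalar_integrable_iff:
  assumes "f \<in> borel_measurable M"
  shows "scalar_integrable M \<nu> f \<longleftrightarrow> integrable M (\<lambda>\<omega>. f \<omega> * \<phi> \<omega>)"
  unfolding scalar_integrable_def variation_measure_eq_density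
  using assms by (simp add: integrable_density integrable_abs_mult_iff)

lemma nn_integral_variation_measure:
  assumes "f \<in> borel_measurable M"
  shows "(\<integral>\<^sup>+ \<omega>. ennreal \<bar>f \<omega>\<bar> \<partial>variation_measure M \<nu>) = (\<integral>\<^sup>+ \<omega>. ennreal \<bar>f \<omega> * \<phi> \<omega>\<bar> \<partial>M)"
  unfolding variation_measure_eq_density using assms
  by (subst nn_integral_density)
     (auto intro!: nn_integral_cong simp: abs_mult ennreal_mult mult.commute)

end

text \<open>The densities of the Jordan parts are the positive and negative parts of \<phi>, whose
  difference is \<phi>. The proof applies \<open>jordan_pos_eq_density\<close> both to \<phi> and to
  -\<phi>, hence its place outside the context that fixes one density.\<close>

lemma scalar_integral_eq:
  assumes int: "integrable M \<phi>"
    and eq: "\<And>A. A \<in> sets M \<Longrightarrow> \<nu> A = (LINT \<omega>:A|M. \<phi> \<omega>)"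
    and [measurable]: "f \<in> borel_measurable M" "A \<in> sets M"
    and f: "integrable M (\<lambda>\<omega>. f \<omega> * \<phi> \<omega>)"
  shows "scalar_integral M \<nu> A f = (LINT \<omega>:A|M. f \<omega> * \<phi> \<omega>)"
proof -
  have [measurable]: "\<phi> \<in> borel_measurable M" using int by auto
  have neg: "jordan_neg M \<nu> = density M (\<lambda>\<omega>. ennreal (max 0 (- \<phi> \<omega>)))"
    unfolding jordan_neg_def
  proof (rule jordan_pos_eq_density)
    show "- \<nu> A = (LINT \<omega>:A|M. - \<phi> \<omega>)" if "A \<in> sets M" for A
      using eq[OF that] by (simp add: set_lebesgue_integral_def)
  qed (use int in auto)
  have pos: "jordan_pos M \<nu> = density M (\<lambda>\<omega>. ennreal (max 0 (\<phi> \<omega>)))"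
    using int eq by (rule jordan_pos_eq_density)
  \<comment> \<open>Both integrands are dominated by |f \<phi>|, so the two integrals may be merged
    into one.\<close>
  have I: "integrable M (\<lambda>\<omega>. max 0 (\<phi> \<omega>) * (indicator A \<omega> * f \<omega>))"
      "integrable M (\<lambda>\<omega>. max 0 (- \<phi> \<omega>) * (indicator A \<omega> * f \<omega>))"
    by (auto intro!: Bochner_Integration.integrable_bound[OF f] simp: abs_mult max_def indicator_def mult_nonneg_nonpos)
  have "scalar_integral M \<nu> A f =
      (LINT \<omega>|M. max 0 (\<phi> \<omega>) * (indicator A \<omega> * f \<omega>)) - (LINT \<omega>|M. max 0 (- \<phi> \<omega>) * (indicator A \<omega> * f \<omega>))"
    unfolding scalar_integral_def neg pos set_lebesgue_integral_def
    by (simp add: integral_density)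
  also have "\<dots> = (LINT \<omega>|M. max 0 (\<phi> \<omega>) * (indicator A \<omega> * f \<omega>) - max 0 (- \<phi> \<omega>) * (indicator A \<omega> * f \<omega>))"
    using I by (rule Bochner_Integration.integral_diff[symmetric])
  also have "\<dots> = (LINT \<omega>:A|M. f \<omega> * \<phi> \<omega>)"
    unfolding set_lebesgue_integral_def
    by (rule Bochner_Integration.integral_cong) (auto simp: max_def)
  finally show ?thesis .
qed


context ac_signed_measure
begin

lemma scalar_integrable_rn_density:
  "f \<in> borel_measurable M \<Longrightarrow>
    scalar_integrable M \<nu> f \<longleftrightarrow> integrable M (\<lambda>\<omega>. f \<omega> * rn_density M \<nu> \<omega>)"
  by (intro scalar_integrable_iff integrable_rn_density rn_density)

lemma scalar_integral_rn_density:
  "f \<in> borel_measurable M \<Longrightarrow> A \<in> sets M \<Longrightarrow> integrable M (\<lambda>\<omega>. f \<omega> * rn_density M \<nu> \<omega>) \<Longrightarrow>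
    scalar_integral M \<nu> A f = (LINT \<omega>:A|M. f \<omega> * rn_density M \<nu> \<omega>)"
  by (intro scalar_integral_eq integrable_rn_density rn_density)

lemma nn_integral_variation_rn_density:
  "f \<in> borel_measurable M \<Longrightarrow>
    (\<integral>\<^sup>+ \<omega>. ennreal \<bar>f \<omega>\<bar> \<partial>variation_measure M \<nu>) = (\<integral>\<^sup>+ \<omega>. ennreal \<bar>f \<omega> * rn_density M \<nu> \<omega>\<bar> \<partial>M)"
  by (intro nn_integral_variation_measure integrable_rn_density rn_density)

end

section \<open>Integration with respect to a vector measure\<close>

locale ac_vector_measure = finite_measure M
  for M :: "'a measure" +
  fixes m :: "'a set \<Rightarrow> 'b::banach"
  assumes vector_measure: "vector_measure M m"
    and absolutely_continuous: "vm_absolutely_continuous M m"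
begin

text \<open>The partition of \<open>A\<close> into the single block \<open>A\<close> shows that the
  semivariation dominates |y(m A)| for every \<open>y\<close> in the dual unit ball; a general
  functional is rescaled into the ball.\<close>

lemma dual_measure_null:
  assumes A: "A \<in> sets M" "emeasure M A = 0"
  shows "dual_measure m x A = 0"
\<comment> \<open>The single block has to be nonempty and the functional nonzero for the rescaling,
  so the two exceptions are settled first.\<close>
proof (cases "A = {} \<or> x = 0")
  case True
  have "(\<lambda>i::nat. m {}) sums m (\<Union>i::nat. {})"
    using vector_measure unfolding vector_measure_def
    by (elim allE[of _ "\<lambda>i. {}"]) (auto simp: disjoint_family_on_def)
  then have "m {} = 0"
    using sums_summable summable_const_iff by blast
  then show ?thesis using True by (auto simp: dual_measure_def)
next
  case False
  define y where "y = (1 / norm x) *\<^sub>R x"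
  have y: "norm y \<le> 1" using False by (simp add: y_def)
  have "ennreal \<bar>dual_measure m y A\<bar> = (\<Sum>B\<in>{A}. ennreal \<bar>dual_measure m y B\<bar>)" by simp
  also have "\<dots> \<le> variation M (dual_measure m y) A"
    unfolding variation_def using A False by (intro SUP_upper) (auto simp: partition_on_def)
  also have "\<dots> \<le> semivariation M m A"
    unfolding semivariation_def using y by (intro SUP_upper) auto
  also have "\<dots> = 0"
    using absolutely_continuous A unfolding vm_absolutely_continuous_def by blast
  finally have "dual_measure m y A = 0" by (simp add: ennreal_eq_0_iff)
  then show ?thesis using False by (simp add: dual_measure_def y_def blinfun.scaleR_left)
qed

sublocale dual: ac_signed_measure M "dual_measure m x" for x
proof
  fix A :: "nat \<Rightarrow> 'a set"
  assume "range A \<subseteq> sets M" "disjoint_family A"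
  then have "(\<lambda>i. m (A i)) sums m (\<Union>i. A i)"
    using vector_measure unfolding vector_measure_def by blast
  then show "(\<lambda>i. dual_measure m x (A i)) sums dual_measure m x (\<Union>i. A i)"
    unfolding dual_measure_def by (rule bounded_linear.sums[OF blinfun.bounded_linear_right])
qed (rule dual_measure_null)

abbreviation density_of :: "('b \<Rightarrow>\<^sub>L real) \<Rightarrow> 'a \<Rightarrow> real" where
  "density_of x \<equiv> rn_density M (dual_measure m x)"

lemma L1_norm_eq:
  assumes "f \<in> borel_measurable M"
  shows "L1_norm M m f = (SUP x\<in>{x. norm x \<le> 1}. \<integral>\<^sup>+ \<omega>. ennreal \<bar>f \<omega> * density_of x \<omega>\<bar> \<partial>M)"
  unfolding L1_norm_def
  using assms by (simp add: dual.nn_integral_variation_rn_density)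

text \<open>This moves integrability with respect to \<open>m\<close> entirely into integrals over
  \<open>M\<close>. The conjuncts are rewritten in order, since evaluating a scalar integral relies
  on the measurability and integrability stated before it.\<close>

lemma vm_integrable_iff:
  "vm_integrable M m f \<longleftrightarrow> f \<in> borel_measurable M \<and>
     (\<forall>x. integrable M (\<lambda>\<omega>. f \<omega> * density_of x \<omega>)) \<and>
     (\<forall>A\<in>sets M. \<exists>y. \<forall>x. blinfun_apply x y = (LINT \<omega>:A|M. f \<omega> * density_of x \<omega>))"
  unfolding vm_integrable_def
  by (auto simp: dual.scalar_integrable_rn_density dual.scalar_integral_rn_density cong: conj_cong)

lemma vm_integral_apply:
  assumes f: "vm_integrable M m f" and A: "A \<in> sets M"
  shows "blinfun_apply x (vm_integral M m A f) = (LINT \<omega>:A|M. f \<omega> * density_of x \<omega>)"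
proof -
  have "\<exists>y. \<forall>x. blinfun_apply x y = scalar_integral M (dual_measure m x) A f"
    using f A unfolding vm_integrable_def by blast
  from someI_ex[OF this] have
    "blinfun_apply x (vm_integral M m A f) = scalar_integral M (dual_measure m x) A f"
    unfolding vm_integral_def by blast
  then show ?thesis
    using f A by (simp add: vm_integrable_iff dual.scalar_integral_rn_density)
qed

lemma vm_integrable_mult_left:
  assumes f: "vm_integrable M m f"
  shows "vm_integrable M m (\<lambda>\<omega>. c * f \<omega>)"
  unfolding vm_integrable_iff
proof (intro conjI ballI allI)
  show "(\<lambda>\<omega>. c * f \<omega>) \<in> borel_measurable M" using f by (auto simp: vm_integrable_iff)
  show "integrable M (\<lambda>\<omega>. c * f \<omega> * density_of x \<omega>)" for x
    using f by (simp add: vm_integrable_iff mult.assoc)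
  fix A assume "A \<in> sets M"
  then obtain y where "\<And>x. blinfun_apply x y = (LINT \<omega>:A|M. f \<omega> * density_of x \<omega>)"
    using f unfolding vm_integrable_iff by blast
  then have "blinfun_apply x (c *\<^sub>R y) = (LINT \<omega>:A|M. c * f \<omega> * density_of x \<omega>)" for x
    by (simp add: blinfun.scaleR_right mult.assoc)
  then show "\<exists>y. \<forall>x. blinfun_apply x y = (LINT \<omega>:A|M. c * f \<omega> * density_of x \<omega>)"
    by blast
qed

text \<open>The integral of f h_A over \<open>B\<close> is the integral of f over
  \<open>B \<inter> A\<close> minus that over \<open>B - A\<close>. Both are elements of the Banach
  space because f has integrals over all measurable sets, so the difference is the required
  element.\<close>

lemma vm_integrable_mult_sign_fun:
  assumes f: "vm_integrable M m f" and A: "A \<in> sets M"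
  shows "vm_integrable M m (\<lambda>\<omega>. f \<omega> * sign_fun M A \<omega>)"
  unfolding vm_integrable_iff
proof (intro conjI ballI allI)
  have [measurable]: "f \<in> borel_measurable M" "A \<in> sets M" using f A by (auto simp: vm_integrable_iff)
  have [measurable]: "sign_fun M A \<in> borel_measurable M" unfolding sign_fun_def by measurable
  show "(\<lambda>\<omega>. f \<omega> * sign_fun M A \<omega>) \<in> borel_measurable M" by measurable
  have fi: "integrable M (\<lambda>\<omega>. f \<omega> * density_of x \<omega>)" for x
    using f by (simp add: vm_integrable_iff)
  show "integrable M (\<lambda>\<omega>. f \<omega> * sign_fun M A \<omega> * density_of x \<omega>)" for x
    by (rule Bochner_Integration.integrable_bound[OF fi])
       (auto simp: sign_fun_def indicator_def abs_mult)
  fix B assume B: "B \<in> sets M"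
  let ?v = "vm_integral M m (B \<inter> A) f - vm_integral M m (B - A) f"
  have "blinfun_apply x ?v = (LINT \<omega>:B|M. f \<omega> * sign_fun M A \<omega> * density_of x \<omega>)" for x
  proof -
    have "blinfun_apply x ?v =
        (LINT \<omega>:B \<inter> A|M. f \<omega> * density_of x \<omega>) - (LINT \<omega>:B - A|M. f \<omega> * density_of x \<omega>)"
      using f A B by (simp add: blinfun.diff_right vm_integral_apply sets.Int sets.Diff)
    also have "\<dots> = (LINT \<omega>:B|M. f \<omega> * sign_fun M A \<omega> * density_of x \<omega>)"
      unfolding set_lebesgue_integral_def
    proof (subst Bochner_Integration.integral_diff[symmetric])
      show "integrable M (\<lambda>\<omega>. indicator (B \<inter> A) \<omega> *\<^sub>R (f \<omega> * density_of x \<omega>))"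
        "integrable M (\<lambda>\<omega>. indicator (B - A) \<omega> *\<^sub>R (f \<omega> * density_of x \<omega>))"
        by (intro integrable_mult_indicator fi sets.Int sets.Diff A B)+
    qed (use sets.sets_into_space[OF B] in
        \<open>auto intro!: Bochner_Integration.integral_cong simp: sign_fun_def indicator_def\<close>)
    finally show ?thesis .
  qed
  then show "\<exists>y. \<forall>x. blinfun_apply x y = (LINT \<omega>:B|M. f \<omega> * sign_fun M A \<omega> * density_of x \<omega>)"
    by blast
qed

lemma L1_norm_mult_left:
  assumes "f \<in> borel_measurable M"
  shows "L1_norm M m (\<lambda>\<omega>. c * f \<omega>) = ennreal \<bar>c\<bar> * L1_norm M m f"
  using assms
  by (simp add: L1_norm_eq abs_mult ennreal_mult nn_integral_cmult SUP_mult_left_ennreal mult.assoc)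

text \<open>The integral of |f \<phi>| is one of the values in the supremum defining the norm.
  Admitting a dominated \<open>g\<close> allows f h_A \<phi> to be bounded by the norm of f.\<close>

lemma integral_le_L1_norm:
  assumes "f \<in> borel_measurable M" "integrable M g" "norm x \<le> 1"
    and g: "\<And>\<omega>. \<omega> \<in> space M \<Longrightarrow> \<bar>g \<omega>\<bar> \<le> \<bar>f \<omega> * density_of x \<omega>\<bar>"
  shows "ennreal (LINT \<omega>|M. g \<omega>) \<le> L1_norm M m f"
proof -
  have "ennreal (LINT \<omega>|M. g \<omega>) \<le> ennreal (norm (LINT \<omega>|M. g \<omega>))" by (intro ennreal_leI) simp
  also have "\<dots> \<le> (\<integral>\<^sup>+ \<omega>. ennreal (norm (g \<omega>)) \<partial>M)"
    using assms(2) by (rule integral_norm_bound_ennreal)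
  also have "\<dots> \<le> (\<integral>\<^sup>+ \<omega>. ennreal \<bar>f \<omega> * density_of x \<omega>\<bar> \<partial>M)"
    using g by (intro nn_integral_mono ennreal_leI) simp
  also have "\<dots> \<le> L1_norm M m f"
    unfolding L1_norm_eq[OF assms(1)] using assms(3) by (intro SUP_upper) auto
  finally show ?thesis .
qed

text \<open>The absolute value in the norm is turned into a linear pairing: the sign of f \<phi> is
  absorbed into the integrable function f h_A, to which weak* convergence applies.\<close>

lemma less_L1_normE:
  assumes f: "vm_integrable M m f" and c: "c < L1_norm M m f"
  obtains x A where "norm x \<le> 1" "A \<in> sets M"
    "c < ennreal (LINT \<omega>|M. f \<omega> * sign_fun M A \<omega> * density_of x \<omega>)"
proof -
  have [measurable]: "f \<in> borel_measurable M" using f by (simp add: vm_integrable_iff)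
  obtain x where x: "norm x \<le> 1" "c < (\<integral>\<^sup>+ \<omega>. ennreal \<bar>f \<omega> * density_of x \<omega>\<bar> \<partial>M)"
    using c unfolding L1_norm_eq[OF \<open>f \<in> borel_measurable M\<close>] less_SUP_iff by auto
  define A where "A = {\<omega>\<in>space M. 0 \<le> f \<omega> * density_of x \<omega>}"
  have "A \<in> sets M" unfolding A_def by measurable
  have "(\<integral>\<^sup>+ \<omega>. ennreal \<bar>f \<omega> * density_of x \<omega>\<bar> \<partial>M) = ennreal (LINT \<omega>|M. \<bar>f \<omega> * density_of x \<omega>\<bar>)"
    using f by (intro nn_integral_eq_integral integrable_abs) (auto simp: vm_integrable_iff)
  also have "(LINT \<omega>|M. \<bar>f \<omega> * density_of x \<omega>\<bar>) = (LINT \<omega>|M. f \<omega> * sign_fun M A \<omega> * density_of x \<omega>)"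
    by (rule Bochner_Integration.integral_cong) (auto simp: A_def sign_fun_def indicator_def abs_if)
  finally show ?thesis using that x \<open>A \<in> sets M\<close> by metis
qed

end

section \<open>Upper and lower bounds for the limit of the norms\<close>

lemma L1_norm_le_of_inclusion_norm:
  assumes "ac_vector_measure M m" "ac_vector_measure M n"
    and "L1_inclusion_norm M m n \<le> 1" and f: "vm_integrable M m f"
  shows "L1_norm M n f \<le> L1_norm M m f"
proof (rule ccontr)
  interpret m: ac_vector_measure M m by fact
  interpret n: ac_vector_measure M n by fact
  assume "\<not> L1_norm M n f \<le> L1_norm M m f"
  \<comment> \<open>Normalizing by the norm of f would fail if that norm were 0. A value strictly
    between the two norms is always positive and finite, so f can be divided by it.\<close>
  then obtain z where z: "L1_norm M m f < z" "z < L1_norm M n f"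
    using dense not_le by metis
  then obtain r where r: "z = ennreal r" "0 < r"
    by (cases z) (auto simp: top_unique, metis ennreal_neg not_less not_less_zero)
  have fm: "f \<in> borel_measurable M" using f by (simp add: m.vm_integrable_iff)
  have "ennreal (1 / r) * L1_norm M m f \<le> ennreal (1 / r) * ennreal r"
    using z r by (intro mult_left_mono) auto
  also have "\<dots> = 1" using r by (simp add: ennreal_mult[symmetric])
  finally have "L1_norm M m (\<lambda>\<omega>. 1 / r * f \<omega>) \<le> 1"
    using r m.L1_norm_mult_left[OF fm, of "1 / r"] by simp
  then have "L1_norm M n (\<lambda>\<omega>. 1 / r * f \<omega>) \<le> L1_inclusion_norm M m n"
    unfolding L1_inclusion_norm_def
    by (intro SUP_upper CollectI conjI m.vm_integrable_mult_left f)
  then have "ennreal (1 / r) * L1_norm M n f \<le> 1"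
    using assms(3) r n.L1_norm_mult_left[OF fm, of "1 / r"] by simp
  then have "ennreal r * (ennreal (1 / r) * L1_norm M n f) \<le> ennreal r * 1"
    by (intro mult_left_mono) auto
  then have "L1_norm M n f \<le> ennreal r"
    using r by (simp add: mult.assoc[symmetric] ennreal_mult[symmetric])
  then show False using z r by simp
qed

text \<open>The term of the supremum at the whole space controls the difference of the integrals of
  f, since h_A is 1 on the space for that choice. Applying the functional costs a factor
  \<open>norm x\<close>.\<close>

lemma weak_star_of_uniform_sign_convergence:
  fixes m :: "'a set \<Rightarrow> 'b::banach" and mn :: "'i \<Rightarrow> 'a set \<Rightarrow> 'b"
  assumes m: "ac_vector_measure M m"
    and mn: "\<forall>\<^sub>F i in F. ac_vector_measure M (mn i) \<and> vm_integrable M (mn i) f"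
    and f: "vm_integrable M m f"
    and lim: "((\<lambda>i. SUP A\<in>sets M. ennreal (norm
                (vm_integral M m (space M) (\<lambda>\<omega>. f \<omega> * sign_fun M A \<omega>)
                 - vm_integral M (mn i) (space M) (\<lambda>\<omega>. f \<omega> * sign_fun M A \<omega>)))) \<longlongrightarrow> 0) F"
  shows "((\<lambda>i. LINT \<omega>|M. f \<omega> * rn_density M (dual_measure (mn i) x) \<omega>)
              \<longlongrightarrow> (LINT \<omega>|M. f \<omega> * rn_density M (dual_measure m x) \<omega>)) F"
proof -
  define g where "g = (\<lambda>\<omega>. f \<omega> * sign_fun M (space M) \<omega>)"
  define d where "d i = norm (vm_integral M m (space M) g - vm_integral M (mn i) (space M) g)" for i
  have "((\<lambda>i. ennreal (d i)) \<longlongrightarrow> 0) F"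
  proof (rule tendsto_sandwich[OF _ _ tendsto_const lim])
    show "\<forall>\<^sub>F i in F. ennreal (d i) \<le> (SUP A\<in>sets M. ennreal (norm
                (vm_integral M m (space M) (\<lambda>\<omega>. f \<omega> * sign_fun M A \<omega>)
                 - vm_integral M (mn i) (space M) (\<lambda>\<omega>. f \<omega> * sign_fun M A \<omega>))))"
      unfolding d_def g_def by (intro always_eventually allI SUP_upper sets.top)
  qed simp
  then have d: "(d \<longlongrightarrow> 0) F"
    by (subst (asm) ennreal_0[symmetric], subst (asm) tendsto_ennreal_iff) (auto simp: d_def)
  \<comment> \<open>Proved for any measure \<open>n\<close> because it is used for \<open>m\<close>
    and for \<open>mn i\<close> alike.\<close>
  have eq: "blinfun_apply x (vm_integral M n (space M) g) = (LINT \<omega>|M. f \<omega> * rn_density M (dual_measure n x) \<omega>)"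
    if "ac_vector_measure M n" "vm_integrable M n f" for n :: "'a set \<Rightarrow> 'b"
  proof -
    interpret n: ac_vector_measure M n by fact
    have "blinfun_apply x (vm_integral M n (space M) g) = (LINT \<omega>:space M|M. g \<omega> * n.density_of x \<omega>)"
      unfolding g_def using that by (intro n.vm_integral_apply n.vm_integrable_mult_sign_fun) auto
    also have "\<dots> = (LINT \<omega>|M. f \<omega> * n.density_of x \<omega>)"
      unfolding set_lebesgue_integral_def g_def
      by (rule Bochner_Integration.integral_cong) (auto simp: sign_fun_def)
    finally show ?thesis .
  qed
  show ?thesis
  proof (rule LIM_zero_cancel, rule Lim_null_comparison)
    show "((\<lambda>i. norm x * d i) \<longlongrightarrow> 0) F"
      using tendsto_mult_left[OF d, of "norm x"] by simp
    show "\<forall>\<^sub>F i in F. norm ((LINT \<omega>|M. f \<omega> * rn_density M (dual_measure (mn i) x) \<omega>)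
        - (LINT \<omega>|M. f \<omega> * rn_density M (dual_measure m x) \<omega>)) \<le> norm x * d i"
      using mn
    proof eventually_elim
      case (elim i)
      have "norm (blinfun_apply x (vm_integral M (mn i) (space M) g - vm_integral M m (space M) g)) \<le> norm x * d i"
        using norm_blinfun[of x "vm_integral M (mn i) (space M) g - vm_integral M m (space M) g"]
        by (simp add: d_def norm_minus_commute)
      then show ?case
        using elim m f by (simp add: blinfun.diff_right eq)
    qed
  qed
qed

text \<open>This is lower semicontinuity of the norm along the filter: \<open>x\<close> and
  \<open>A\<close> are chosen once, from \<open>m\<close>, and stay fixed while the index varies, so
  convergence of a single pairing suffices.\<close>

lemma eventually_less_L1_norm:
  fixes m :: "'a set \<Rightarrow> 'b::banach" and mn :: "'i \<Rightarrow> 'a set \<Rightarrow> 'b"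
  assumes m: "ac_vector_measure M m"
    and mn: "\<forall>\<^sub>F i in F. ac_vector_measure M (mn i) \<and> L1_included M m (mn i)"
    and lim: "\<And>x f. vm_integrable M m f \<Longrightarrow>
      ((\<lambda>i. LINT \<omega>|M. f \<omega> * rn_density M (dual_measure (mn i) x) \<omega>)
              \<longlongrightarrow> (LINT \<omega>|M. f \<omega> * rn_density M (dual_measure m x) \<omega>)) F"
    and f: "vm_integrable M m f" and c: "c < L1_norm M m f"
  shows "\<forall>\<^sub>F i in F. c < L1_norm M (mn i) f"
proof -
  interpret m: ac_vector_measure M m by fact
  obtain x A where x: "norm x \<le> 1" and A: "A \<in> sets M"
    and less: "c < ennreal (LINT \<omega>|M. f \<omega> * sign_fun M A \<omega> * m.density_of x \<omega>)"
    using m.less_L1_normE[OF f c] by blast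
  let ?g = "\<lambda>\<omega>. f \<omega> * sign_fun M A \<omega>"
  have g: "vm_integrable M m ?g" using f A by (rule m.vm_integrable_mult_sign_fun)
  have "\<forall>\<^sub>F i in F. c < ennreal (LINT \<omega>|M. ?g \<omega> * rn_density M (dual_measure (mn i) x) \<omega>)"
    using order_tendstoD(1)[OF tendsto_ennrealI[OF lim[OF g]] less] .
  with mn show ?thesis
  proof eventually_elim
    case (elim i)
    interpret n: ac_vector_measure M "mn i" using elim by blast
    have "vm_integrable M (mn i) f" "vm_integrable M (mn i) ?g"
      using elim f g by (auto simp: L1_included_def)
    \<comment> \<open>Since |h_A| = 1 on the space, |f h_A \<phi>| equals |f \<phi>|, so the bound
      is the norm of f.\<close>
    then have "ennreal (LINT \<omega>|M. ?g \<omega> * n.density_of x \<omega>) \<le> L1_norm M (mn i) f"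
      using x by (intro n.integral_le_L1_norm[of _ _ x])
        (auto simp: n.vm_integrable_iff sign_fun_def indicator_def)
    then show ?case using elim by order
  qed
qed

theorem theorem3p4:
  fixes M :: "'a measure"
    and L :: "'i set" and le :: "'i \<Rightarrow> 'i \<Rightarrow> bool"
    and m :: "'a set \<Rightarrow> 'b::banach"
    and mn :: "'i \<Rightarrow> 'a set \<Rightarrow> 'b"
  assumes "finite_measure M"
    and "directed_set L le"
    and "vector_measure M m"
    and "\<And>i. i \<in> L \<Longrightarrow> vector_measure M (mn i)"
    and "vm_absolutely_continuous M m"
    and "\<And>i. i \<in> L \<Longrightarrow> vm_absolutely_continuous M (mn i)"
    and "\<And>i. i \<in> L \<Longrightarrow> L1_included M m (mn i)"
    and "\<And>i. i \<in> L \<Longrightarrow> L1_inclusion_norm M m (mn i) = 1"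
    and "(\<forall>f. vm_integrable M m f \<longrightarrow>
            ((\<lambda>i. SUP A\<in>sets M. ennreal (norm
                (vm_integral M m (space M) (\<lambda>\<omega>. f \<omega> * sign_fun M A \<omega>)
                 - vm_integral M (mn i) (space M) (\<lambda>\<omega>. f \<omega> * sign_fun M A \<omega>))))
              \<longlongrightarrow> 0) (net_filter L le))
         \<or>
         (\<forall>x :: 'b \<Rightarrow>\<^sub>L real. \<forall>f. vm_integrable M m f \<longrightarrow>
            ((\<lambda>i. LINT \<omega>|M. f \<omega> * rn_density M (dual_measure (mn i) x) \<omega>)
              \<longlongrightarrow> (LINT \<omega>|M. f \<omega> * rn_density M (dual_measure m x) \<omega>)) (net_filter L le))"
  shows "\<forall>f. vm_integrable M m f \<longrightarrow>
           ((\<lambda>i. L1_norm M (mn i) f) \<longlongrightarrow> L1_norm M m f) (net_filter L le)"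
proof (intro allI impI)
  fix f assume f: "vm_integrable M m f"
  have m: "ac_vector_measure M m"
    using assms(1,3,5) by (simp add: ac_vector_measure_def ac_vector_measure_axioms_def)
  have mn: "ac_vector_measure M (mn i)" if "i \<in> L" for i
    using assms(1,4,6) that by (simp add: ac_vector_measure_def ac_vector_measure_axioms_def)
  \<comment> \<open>The hypotheses speak of indices in \<open>L\<close> only; the tails generating
    the filter lie in \<open>L\<close>, so they hold eventually.\<close>
  have L: "\<forall>\<^sub>F i in net_filter L le. i \<in> L"
    using assms(2) eventually_net_filter[OF assms(2)] by (auto simp: directed_set_def)
  have lim: "((\<lambda>i. LINT \<omega>|M. h \<omega> * rn_density M (dual_measure (mn i) x) \<omega>)
              \<longlongrightarrow> (LINT \<omega>|M. h \<omega> * rn_density M (dual_measure m x) \<omega>)) (net_filter L le)"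
    if h: "vm_integrable M m h" for h x
    using assms(9)
  proof
    assume *: "\<forall>f. vm_integrable M m f \<longrightarrow>
            ((\<lambda>i. SUP A\<in>sets M. ennreal (norm
                (vm_integral M m (space M) (\<lambda>\<omega>. f \<omega> * sign_fun M A \<omega>)
                 - vm_integral M (mn i) (space M) (\<lambda>\<omega>. f \<omega> * sign_fun M A \<omega>))))
              \<longlongrightarrow> 0) (net_filter L le)"
    have "\<forall>\<^sub>F i in net_filter L le. ac_vector_measure M (mn i) \<and> vm_integrable M (mn i) h"
      using L by eventually_elim (use mn assms(7) h in \<open>auto simp: L1_included_def\<close>)
    then show ?thesis
      using m h * by (intro weak_star_of_uniform_sign_convergence) blast+
  qed (use h in blast)
  show "((\<lambda>i. L1_norm M (mn i) f) \<longlongrightarrow> L1_norm M m f) (net_filter L le)"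
  proof (rule order_tendstoI)
    fix c assume "c < L1_norm M m f"
    moreover have "\<forall>\<^sub>F i in net_filter L le. ac_vector_measure M (mn i) \<and> L1_included M m (mn i)"
      using L by eventually_elim (use mn assms(7) in auto)
    ultimately show "\<forall>\<^sub>F i in net_filter L le. c < L1_norm M (mn i) f"
      using m f lim by (intro eventually_less_L1_norm[where m = m])
  next
    \<comment> \<open>For this side no passage to the limit is made: the inclusion bounds the norm
      at every index in \<open>L\<close>.\<close>
    fix c assume c: "L1_norm M m f < c"
    have "L1_norm M (mn i) f \<le> L1_norm M m f" if "i \<in> L" for i
      using assms(8)[OF that] by (intro L1_norm_le_of_inclusion_norm m mn[OF that] f) simp
    then show "\<forall>\<^sub>F i in net_filter L le. L1_norm M (mn i) f < c"
      using L c by (auto elim!: eventually_mono intro: le_less_trans)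
  qed
qed

end
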